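(* Let $(u_\lambda,v_\lambda,\kappa_\lambda)_{\lambda\in\Lambda}$ be a diagonal frame decomposition (DFD) of $\mathbf K$. Then the following assertions hold. (a) If $\inf_{\lambda\in\Lambda}\kappa_\lambda>0$, then $\mathbf K^{+}$ is bounded. (b) If $\boldsymbol v=(v_\lambda)_{\lambda\in\Lambda}$ is norm bounded from below and $\mathbf K^{+}$ is bounded, then $\inf_{\lambda\in\Lambda}\kappa_\lambda>0$.
   Context: $\mathbb X,\mathbb Y$ are Hilbert spaces over $\mathbb R$ or $\mathbb C$, and $\mathbf K\colon\operatorname{dom}(\mathbf K)\subseteq\mathbb X\to\mathbb Y$ is a closed, densely defined (possibly unbounded) linear operator. $\Lambda$ is an at most countable index set. Frames: a family $(u_\lambda)_{\lambda\in\Lambda}$ in a Hilbert space $\mathbb U$ is a frame for $\mathbb U$ if there are $A,B>0$ with $A\|x\|^2\le\sum_{\lambda}|\langle u_\lambda,x\rangle|^2\le B\|x\|^2$ for all $x\in\mathbb U$. A frame $(u_\lambda)_\lambda$ is norm bounded from below if there is $a>0$ with $\inf_{\lambda}\|u_\lambda\|\ge a$. DFD: $(u_\lambda,v_\lambda,\kappa_\lambda)_{\lambda\in\Lambda}$ is a DFD for $\mathbf K$ if $(u_\lambda)_\lambda$ is a frame for $(\ker\mathbf K)^\perp\subseteq\mathbb X$, $(v_\lambda)_\lambda$ is a frame for $\overline{\operatorname{ran}\mathbf K}\subseteq\mathbb Y$, $\kappa_\lambda\in(0,\infty)$ for all $\lambda$, and $v_\lambda\in\operatorname{dom}(\mathbf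 K^* )$ with $\mathbf K^*v_\lambda=\kappa_\lambda u_\lambda$ for all $\lambda\in\Lambda$. Moore–Penrose inverse: $\mathbf K^{+}\colon\operatorname{dom}(\mathbf K^{+})\to\mathbb X$ with $\operatorname{dom}(\mathbf K^{+})=\operatorname{ran}(\mathbf K)\oplus\operatorname{ran}(\mathbf K)^\perp$, where $\mathbf K^{+}y$ is the unique solution $x\in\operatorname{dom}(\mathbf K)\cap(\ker\mathbf K)^\perp$ of $\mathbf Kx=\mathbf P_{\overline{\operatorname{ran}\mathbf K}}\,y$ ($\mathbf P$ denotes orthogonal projection). $\mathbf K^{+}$ is bounded if $\|\mathbf K^{+}y\|\le C\|y\|$ on $\operatorname{dom}(\mathbf K^{+})$ for some constant $C$. *)

theory Defs
  imports "HOL-Analysis.Analysis"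
begin

text \<open>
  Scalar fields. The axioms force the field to be (isometrically) the reals with the identity or
  the complex numbers with complex conjugation: \<open>x = scnj x\<close> gives \<open>x\<^sup>2 = of_real ((norm x)\<^sup>2)\<close>, so
  \<open>x\<close> is real; hence \<open>x + scnj x\<close> and \<open>x * scnj x\<close> are always real, and every element is quadratic
  over the reals.
\<close>

class rc_field = real_normed_field +
  fixes scnj :: "'a \<Rightarrow> 'a"
  assumes scnj_add: "scnj (x + y) = scnj x + scnj y"
    and scnj_mult: "scnj (x * y) = scnj x * scnj y"
    and scnj_scnj: "scnj (scnj x) = x"
    and mult_scnj: "x * scnj x = (norm x)\<^sup>2 *\<^sub>R 1"

instantiation real :: rc_field
begin
definition scnj_real :: "real \<Rightarrow> real" where "scnj_real x = x"
instance by standard (auto simp: scnj_real_def power2_eq_square)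
end

instantiation complex :: rc_field
begin
definition scnj_complex :: "complex \<Rightarrow> complex" where "scnj_complex = cnj"
instance by standard (auto simp: scnj_complex_def complex_norm_square[symmetric] scaleR_conv_of_real)
end

text \<open>
  A Hilbert space over \<open>'k\<close> is carried by a whole type. The library has only real inner product
  spaces, so scalar multiplication and inner product (linear in the first argument) are explicit.
  The norm and topology are those of the type, tied to the inner product by
  \<open>ip_self\<close>; completeness is part of the class \<open>banach\<close>.
\<close>

locale hilbert_space = vector_space scale
  for scale :: "'k::rc_field \<Rightarrow> 'a::banach \<Rightarrow> 'a" +
  fixes ip :: "'a \<Rightarrow> 'a \<Rightarrow> 'k"
  assumes scale_of_real: "scale (of_real r) x = r *\<^sub>R x"
    and ip_add_left: "ip (x + y) z = ip x z + ip y z"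
    and ip_scale_left: "ip (scale c x) y = c * ip x y"
    and ip_commute: "ip x y = scnj (ip y x)"
    and ip_self: "ip x x = of_real ((norm x)\<^sup>2)"

lemma hilbert_space_real:
  "hilbert_space (scaleR :: real \<Rightarrow> 'a::{real_inner,banach} \<Rightarrow> 'a) inner"
  by unfold_locales
    (auto simp: algebra_simps inner_commute scnj_real_def power2_norm_eq_inner)

lemma hilbert_space_complex:
  "hilbert_space ((*) :: complex \<Rightarrow> complex \<Rightarrow> complex) (\<lambda>x y. x * cnj y)"
  by unfold_locales
    (auto simp: algebra_simps scnj_complex_def complex_norm_square[symmetric] scaleR_conv_of_real)

definition orth_compl :: "('a \<Rightarrow> 'a \<Rightarrow> 'k::zero) \<Rightarrow> 'a set \<Rightarrow> 'a set" where
  "orth_compl ip S = {x. \<forall>s\<in>S. ip x s = 0}"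

text \<open>Meaningful when \<open>U\<close> is a closed subspace.\<close>

definition orth_proj :: "('a \<Rightarrow> 'a \<Rightarrow> 'k::zero) \<Rightarrow> 'a set \<Rightarrow> 'a::ab_group_add \<Rightarrow> 'a" where
  "orth_proj ip U y = (THE p. p \<in> U \<and> y - p \<in> orth_compl ip U)"

text \<open>
  An unbounded operator is a domain \<open>D\<close> together with a total function \<open>K\<close>; the values of \<open>K\<close>
  outside \<open>D\<close> are junk and must not matter.
\<close>

definition closed_densely_defined ::
  "('k::field \<Rightarrow> 'x::real_normed_vector \<Rightarrow> 'x) \<Rightarrow> ('k \<Rightarrow> 'y::real_normed_vector \<Rightarrow> 'y) \<Rightarrow>
   'x set \<Rightarrow> ('x \<Rightarrow> 'y) \<Rightarrow> bool" where
  "closed_densely_defined scaleX scaleY D K \<longleftrightarrow>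
     module.subspace scaleX D \<and>
     (\<forall>x\<in>D. \<forall>y\<in>D. K (x + y) = K x + K y) \<and>
     (\<forall>c. \<forall>x\<in>D. K (scaleX c x) = scaleY c (K x)) \<and>
     closure D = UNIV \<and>
     closed {(x, K x) | x. x \<in> D}"

definition op_ker :: "'x set \<Rightarrow> ('x \<Rightarrow> 'y::zero) \<Rightarrow> 'x set" where
  "op_ker D K = {x \<in> D. K x = 0}"

definition op_ran :: "'x set \<Rightarrow> ('x \<Rightarrow> 'y) \<Rightarrow> 'y set" where
  "op_ran D K = K ` D"

definition adj_dom ::
  "('x \<Rightarrow> 'x \<Rightarrow> 'k) \<Rightarrow> ('y \<Rightarrow> 'y \<Rightarrow> 'k) \<Rightarrow> 'x set \<Rightarrow> ('x \<Rightarrow> 'y) \<Rightarrow> 'y set" where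
  "adj_dom ipX ipY D K = {y. \<exists>z. \<forall>x\<in>D. ipY (K x) y = ipX x z}"

text \<open>The representing vector is unique because \<open>D\<close> is dense.\<close>

definition adj ::
  "('x \<Rightarrow> 'x \<Rightarrow> 'k) \<Rightarrow> ('y \<Rightarrow> 'y \<Rightarrow> 'k) \<Rightarrow> 'x set \<Rightarrow> ('x \<Rightarrow> 'y) \<Rightarrow> 'y \<Rightarrow> 'x" where
  "adj ipX ipY D K y = (THE z. \<forall>x\<in>D. ipY (K x) y = ipX x z)"

definition is_frame ::
  "('a \<Rightarrow> 'a \<Rightarrow> 'k::real_normed_field) \<Rightarrow> 'a::real_normed_vector set \<Rightarrow>
   'i set \<Rightarrow> ('i \<Rightarrow> 'a) \<Rightarrow> bool" where
  "is_frame ip U \<Lambda> u \<longleftrightarrow>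
     (\<forall>l\<in>\<Lambda>. u l \<in> U) \<and>
     (\<exists>A>0. \<exists>B>0. \<forall>x\<in>U.
        (\<lambda>l. (norm (ip (u l) x))\<^sup>2) summable_on \<Lambda> \<and>
        A * (norm x)\<^sup>2 \<le> (\<Sum>\<^sub>\<infinity>l\<in>\<Lambda>. (norm (ip (u l) x))\<^sup>2) \<and>
        (\<Sum>\<^sub>\<infinity>l\<in>\<Lambda>. (norm (ip (u l) x))\<^sup>2) \<le> B * (norm x)\<^sup>2)"

text \<open>Infima are taken in the extended reals, so that the infimum over an empty index set is \<open>\<infinity>\<close>.\<close>

definition norm_bounded_below :: "'i set \<Rightarrow> ('i \<Rightarrow> 'a::real_normed_vector) \<Rightarrow> bool" where
  "norm_bounded_below \<Lambda> u \<longleftrightarrow> (\<exists>a>0. ereal a \<le> (INF l\<in>\<Lambda>. ereal (norm (u l))))"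

definition is_DFD ::
  "('x \<Rightarrow> 'x \<Rightarrow> 'k::real_normed_field) \<Rightarrow> ('y \<Rightarrow> 'y \<Rightarrow> 'k) \<Rightarrow>
   'x::real_normed_vector set \<Rightarrow> ('x \<Rightarrow> 'y::real_normed_vector) \<Rightarrow>
   'i set \<Rightarrow> ('i \<Rightarrow> 'x) \<Rightarrow> ('i \<Rightarrow> 'y) \<Rightarrow> ('i \<Rightarrow> real) \<Rightarrow> bool" where
  "is_DFD ipX ipY D K \<Lambda> u v \<kappa> \<longleftrightarrow>
     is_frame ipX (orth_compl ipX (op_ker D K)) \<Lambda> u \<and>
     is_frame ipY (closure (op_ran D K)) \<Lambda> v \<and>
     (\<forall>l\<in>\<Lambda>. 0 < \<kappa> l) \<and>
     (\<forall>l\<in>\<Lambda>. v l \<in> adj_dom ipX ipY D K \<and> adj ipX ipY D K (v l) = \<kappa> l *\<^sub>R u l)"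

definition mp_dom ::
  "('y \<Rightarrow> 'y \<Rightarrow> 'k::zero) \<Rightarrow> 'x set \<Rightarrow> ('x \<Rightarrow> 'y::ab_group_add) \<Rightarrow> 'y set" where
  "mp_dom ipY D K = {r + s | r s. r \<in> op_ran D K \<and> s \<in> orth_compl ipY (op_ran D K)}"

definition mp_inverse ::
  "('x \<Rightarrow> 'x \<Rightarrow> 'k::zero) \<Rightarrow> ('y \<Rightarrow> 'y \<Rightarrow> 'k) \<Rightarrow> 'x set \<Rightarrow>
   ('x \<Rightarrow> 'y::real_normed_vector) \<Rightarrow> 'y \<Rightarrow> 'x" where
  "mp_inverse ipX ipY D K y =
     (THE x. x \<in> D \<inter> orth_compl ipX (op_ker D K) \<and>
             K x = orth_proj ipY (closure (op_ran D K)) y)"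

definition mp_bounded ::
  "('x::real_normed_vector \<Rightarrow> 'x \<Rightarrow> 'k::zero) \<Rightarrow> ('y \<Rightarrow> 'y \<Rightarrow> 'k) \<Rightarrow> 'x set \<Rightarrow>
   ('x \<Rightarrow> 'y::real_normed_vector) \<Rightarrow> bool" where
  "mp_bounded ipX ipY D K \<longleftrightarrow>
     (\<exists>C. \<forall>y\<in>mp_dom ipY D K. norm (mp_inverse ipX ipY D K y) \<le> C * norm y)"

end

theory Submission
  imports Defs
begin

text \<open>
  On the part of the domain orthogonal to the kernel, the identity
  \<open>\<kappa> l * ip (u l) x = ip (v l) (K x)\<close> ties the frame coefficients of \<open>x\<close> to those of \<open>K x\<close>.
  Boundedness of the Moore--Penrose inverse is nothing but an estimate
  \<open>norm x \<le> C * norm (K x)\<close> for these \<open>x\<close>.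

  For (a), the lower frame bound for \<open>u\<close>, the identity, \<open>\<kappa> l \<ge> c\<close>, and the upper frame bound
  for \<open>v\<close> give in this order
  \<open>A * (norm x)\<^sup>2 \<le> (\<Sum>l. (norm (ip (u l) x))\<^sup>2) \<le> (\<Sum>l. (norm (ip (v l) (K x)))\<^sup>2) / c\<^sup>2 \<le> B * (norm (K x))\<^sup>2 / c\<^sup>2\<close>.

  For (b), boundedness of the inverse dualizes to \<open>norm w \<le> C * norm z\<close> whenever \<open>z\<close> is the value
  of the adjoint at some \<open>w\<close> in the closure of the range. For \<open>w = v l\<close> this value is
  \<open>\<kappa> l *\<^sub>R u l\<close>, and the upper frame bound \<open>B\<close> for \<open>u\<close> limits \<open>norm (u l)\<close> to \<open>sqrt B\<close>. So
  \<open>norm (v l) \<le> C * \<kappa> l * sqrt B\<close>, and a lower bound for \<open>norm (v l)\<close> becomes one for \<open>\<kappa> l\<close>.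

  Both parts rest on the orthogonal splitting of the domain along the kernel, which is a closed
  subspace because the graph is closed. It comes from the projection theorem, proved here over
  both scalar fields at once.
\<close>

section \<open>Hilbert space geometry over the reals or the complex numbers\<close>

lemma scnj_0 [simp]: "scnj (0::'k::rc_field) = 0"
  using scnj_add[of "0::'k" 0] by simp

lemma norm_scnj [simp]: "norm (scnj x) = norm (x::'k::rc_field)"
proof (cases "x = 0")
  case False
  have "norm x * norm (scnj x) = norm (x * scnj x)"
    by (simp add: norm_mult)
  also have "\<dots> = norm x * norm x"
    by (simp add: mult_scnj power2_eq_square)
  finally show ?thesis
    using False by simp
qed simp

context hilbert_space
begin

lemma ip_add_right: "ip x (y + z) = ip x y + ip x z"
  by (simp add: ip_commute[of x] ip_add_left scnj_add)

lemma ip_zero_left [simp]: "ip 0 y = 0"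
  using ip_add_left[of 0 0 y] by simp

lemma ip_diff_left: "ip (x - y) z = ip x z - ip y z"
  using ip_add_left[of "x - y" y z] by simp

lemma ip_diff_right: "ip x (y - z) = ip x y - ip x z"
  using ip_add_right[of x "y - z" z] by simp

lemma ip_zero_commute: "ip x y = 0 \<Longrightarrow> ip y x = 0"
  using ip_commute[of y x] by simp

lemma norm_ip_commute: "norm (ip x y) = norm (ip y x)"
  using ip_commute[of x y] by simp

lemma ip_scaleR_left: "ip (r *\<^sub>R x) y = r *\<^sub>R ip x y"
  by (simp flip: scale_of_real add: ip_scale_left scaleR_conv_of_real)

lemma ip_self_eq_0D: "ip x x = 0 \<Longrightarrow> x = 0"
  by (simp add: ip_self)

lemma norm_ip_self: "norm (ip x x) = (norm x)\<^sup>2"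
  by (simp add: ip_self norm_power)

lemma norm_scale: "norm (scale c x) = norm c * norm x"
proof -
  have "ip (scale c x) (scale c x) = c * scnj c * ip x x"
    by (simp add: ip_scale_left ip_commute[of x "scale c x"] scnj_mult ip_commute[of x x, symmetric])
  also have "\<dots> = of_real ((norm c * norm x)\<^sup>2)"
    by (simp add: mult_scnj ip_self scaleR_conv_of_real power_mult_distrib)
  finally have "(of_real ((norm (scale c x))\<^sup>2) :: 'k) = of_real ((norm c * norm x)\<^sup>2)"
    by (simp only: ip_self)
  then have "(norm (scale c x))\<^sup>2 = (norm c * norm x)\<^sup>2"
    by (simp only: of_real_eq_iff)
  then show ?thesis
    by (simp add: power2_eq_iff_nonneg)
qed

lemma pythagoras:
  fixes x y :: 'a
  assumes "ip x y = 0"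
  shows "(norm (x + y))\<^sup>2 = (norm x)\<^sup>2 + (norm y)\<^sup>2"
proof -
  have "ip (x + y) (x + y) = ip x x + ip y y"
    using assms ip_zero_commute[OF assms] by (simp add: ip_add_left ip_add_right)
  then have "(of_real ((norm (x + y))\<^sup>2) :: 'k) = of_real ((norm x)\<^sup>2 + (norm y)\<^sup>2)"
    by (simp only: ip_self of_real_add)
  then show ?thesis
    by (simp only: of_real_eq_iff)
qed

lemma parallelogram:
  fixes x y :: 'a
  shows "(norm (x + y))\<^sup>2 + (norm (x - y))\<^sup>2 = 2 * (norm x)\<^sup>2 + 2 * (norm y)\<^sup>2"
proof -
  have "ip (x + y) (x + y) + ip (x - y) (x - y) = 2 * ip x x + 2 * ip y y"
    by (simp add: ip_add_left ip_add_right ip_diff_left ip_diff_right)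
  then have "(of_real ((norm (x + y))\<^sup>2 + (norm (x - y))\<^sup>2) :: 'k)
      = of_real (2 * (norm x)\<^sup>2 + 2 * (norm y)\<^sup>2)"
    by (simp only: ip_self of_real_add of_real_mult of_real_numeral)
  then show ?thesis
    by (simp only: of_real_eq_iff)
qed

text \<open>
  Here \<open>scale c y\<close> is the component of \<open>x\<close> along \<open>y\<close>; the statement carries both Cauchy--Schwarz
  and the characterization of nearest points by orthogonality.
\<close>

lemma component_along:
  obtains c where "(norm x)\<^sup>2 = (norm (x - scale c y))\<^sup>2 + (norm (scale c y))\<^sup>2"
    and "norm (ip x y) = norm (scale c y) * norm y"
proof -
  define c where "c = ip x y / of_real ((norm y)\<^sup>2)"
  have c: "c * ip y y = ip x y"
    using ip_zero_commute[OF ip_zero_left, of x] by (cases "y = 0") (simp_all add: c_def ip_self)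
  then have "ip (x - scale c y) y = 0"
    by (simp add: ip_diff_left ip_scale_left)
  then have "ip (scale c y) (x - scale c y) = 0"
    by (simp add: ip_scale_left ip_zero_commute[of "x - scale c y" y])
  then have "(norm ((x - scale c y) + scale c y))\<^sup>2
      = (norm (x - scale c y))\<^sup>2 + (norm (scale c y))\<^sup>2"
    by (rule pythagoras[OF ip_zero_commute])
  then have 1: "(norm x)\<^sup>2 = (norm (x - scale c y))\<^sup>2 + (norm (scale c y))\<^sup>2"
    by simp
  have "norm (ip x y) = norm c * (norm y)\<^sup>2"
    by (simp flip: c add: norm_mult norm_ip_self)
  then have "norm (ip x y) = norm (scale c y) * norm y"
    by (simp add: norm_scale power2_eq_square)
  with 1 show ?thesis
    by (rule that)
qed

lemma cauchy_schwarz: "norm (ip x y) \<le> norm x * norm y"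
proof -
  obtain c where c: "(norm x)\<^sup>2 = (norm (x - scale c y))\<^sup>2 + (norm (scale c y))\<^sup>2"
    "norm (ip x y) = norm (scale c y) * norm y"
    by (rule component_along)
  then have "(norm (scale c y))\<^sup>2 \<le> (norm x)\<^sup>2"
    by simp
  then have "norm (scale c y) \<le> norm x"
    by (simp add: power2_le_iff_abs_le)
  then show ?thesis
    using c(2) by (simp add: mult_right_mono)
qed

lemma continuous_on_ip_left: "continuous_on S (\<lambda>x. ip x y)"
proof -
  have "bounded_linear (\<lambda>x. ip x y)"
    by (rule bounded_linear_intro[where K = "norm y"])
      (simp_all add: ip_add_left ip_scaleR_left cauchy_schwarz)
  then show ?thesis
    by (simp add: linear_continuous_on)
qed

text \<open>Orthogonality and norm estimates are closed conditions, so they pass to the closure.\<close>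

lemma norm_ip_le_closure:
  assumes "\<And>x. x \<in> S \<Longrightarrow> norm (ip x y) \<le> M * norm x" and "x \<in> closure S"
  shows "norm (ip x y) \<le> M * norm x"
proof -
  have "closed {x. norm (ip x y) \<le> M * norm x}"
    by (intro closed_Collect_le continuous_intros continuous_on_ip_left)
  then have "closure S \<subseteq> {x. norm (ip x y) \<le> M * norm x}"
    using assms(1) by (intro closure_minimal) auto
  then show ?thesis
    using assms(2) by blast
qed

lemma orth_compl_closure: "orth_compl ip (closure S) = orth_compl ip S"
proof -
  have "ip y x = 0" if "\<forall>s\<in>S. ip y s = 0" "x \<in> closure S" for x y
  proof -
    have "ip s y = 0" if "s \<in> S" for s
      by (rule ip_zero_commute) (use \<open>\<forall>s\<in>S. ip y s = 0\<close> that in blast)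
    then have "ip x y = 0"
      using norm_ip_le_closure[of S y 0 x] \<open>x \<in> closure S\<close> by simp
    then show ?thesis
      by (rule ip_zero_commute)
  qed
  moreover have "S \<subseteq> closure S"
    by (rule closure_subset)
  ultimately show ?thesis
    unfolding orth_compl_def by blast
qed

text \<open>
  The projection theorem. By the parallelogram law a sequence in \<open>N\<close> whose distances to \<open>d\<close>
  approach the infimum is Cauchy; its limit is nearest to \<open>d\<close>, and subtracting a component along
  \<open>N\<close> from the difference could only bring it closer.
\<close>

theorem orthogonal_decomposition:
  assumes N: "subspace N" "closed N"
  obtains n where "n \<in> N" "d - n \<in> orth_compl ip N"
proof -
  define I where "I = (INF n\<in>N. (norm (d - n))\<^sup>2)"
  have bdd: "bdd_below ((\<lambda>n. (norm (d - n))\<^sup>2) ` N)"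
    by (rule bdd_belowI[of _ 0]) auto
  have ne: "N \<noteq> {}"
    using subspace_0[OF N(1)] by blast
  have I_le: "I \<le> (norm (d - n))\<^sup>2" if "n \<in> N" for n
    unfolding I_def using bdd that by (rule cINF_lower)
  have "\<exists>n\<in>N. (norm (d - n))\<^sup>2 < I + 1 / Suc k" for k
    unfolding I_def using cINF_less_iff[OF ne bdd, of "I + 1 / Suc k"]
    by (simp add: I_def)
  then obtain f where f: "\<And>k. f k \<in> N" "\<And>k. (norm (d - f k))\<^sup>2 < I + 1 / Suc k"
    by metis
  have gap: "(norm (f j - f k))\<^sup>2 \<le> 2 / Suc j + 2 / Suc k" for j k
  proof -
    \<comment> \<open>The midpoint is again in \<open>N\<close>, hence no closer to \<open>d\<close> than the infimum permits.\<close>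
    define m where "m = scale (of_real (1/2)) (f j + f k)"
    have "m \<in> N"
      unfolding m_def using f(1) N(1) by (intro subspace_scale subspace_add)
    have "(d - f k) + (d - f j) = 2 *\<^sub>R (d - m)"
      by (simp only: m_def scale_of_real) (simp add: algebra_simps scaleR_2)
    then have "(norm ((d - f k) + (d - f j)))\<^sup>2 = 4 * (norm (d - m))\<^sup>2"
      by (simp add: power_mult_distrib)
    moreover have "(d - f k) - (d - f j) = f j - f k"
      by simp
    ultimately show ?thesis
      using parallelogram[of "d - f k" "d - f j"] I_le[OF \<open>m \<in> N\<close>] f(2)[of j] f(2)[of k]
      by simp
  qed
  have "Cauchy f"
  proof (rule metric_CauchyI)
    fix e :: real
    assume "0 < e"
    then obtain M where M: "4 / e\<^sup>2 < real M"
      using reals_Archimedean2 by blast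
    have "dist (f j) (f k) < e" if "j \<ge> M" "k \<ge> M" for j k
    proof -
      have "2 / Suc i < e\<^sup>2 / 2" if "i \<ge> M" for i
      proof -
        have "4 / e\<^sup>2 < Suc i"
          using M that by linarith
        then show ?thesis
          using \<open>0 < e\<close> by (simp add: field_simps)
      qed
      then have "(norm (f j - f k))\<^sup>2 < e\<^sup>2"
        using gap[of j k] that by (smt (verit) field_sum_of_halves)
      then show ?thesis
        using \<open>0 < e\<close> by (simp add: dist_norm power_less_imp_less_base)
    qed
    then show "\<exists>M. \<forall>j\<ge>M. \<forall>k\<ge>M. dist (f j) (f k) < e"
      by blast
  qed
  then obtain n where n: "f \<longlonglongrightarrow> n"
    using Cauchy_convergent convergent_def by blast
  have "n \<in> N"
    using N(2) f(1) n by (rule closed_sequentially)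
  have "(\<lambda>k. (norm (d - f k))\<^sup>2) \<longlonglongrightarrow> (norm (d - n))\<^sup>2"
    using n by (intro tendsto_intros)
  moreover have "(\<lambda>k. I + 1 / Suc k) \<longlonglongrightarrow> I + 0"
    using LIMSEQ_inverse_real_of_nat by (intro tendsto_intros) (simp add: inverse_eq_divide)
  ultimately have nearest: "(norm (d - n))\<^sup>2 \<le> I"
    using f(2) by (intro LIMSEQ_le[where Y = "\<lambda>k. I + 1 / Suc k"]) (auto intro: less_imp_le)
  have "ip (d - n) m = 0" if "m \<in> N" for m
  proof -
    obtain c where c: "(norm (d - n))\<^sup>2 = (norm (d - n - scale c m))\<^sup>2 + (norm (scale c m))\<^sup>2"
      "norm (ip (d - n) m) = norm (scale c m) * norm m"
      by (rule component_along)
    have "n + scale c m \<in> N"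
      using \<open>n \<in> N\<close> that N(1) by (intro subspace_add subspace_scale)
    then have "(norm (d - n))\<^sup>2 \<le> (norm (d - n - scale c m))\<^sup>2"
      using I_le[of "n + scale c m"] nearest unfolding diff_diff_eq by (meson order_trans)
    then have "norm (scale c m) = 0"
      using c(1) by simp
    then have "norm (ip (d - n) m) = 0"
      using c(2) by (simp only: mult_zero_left)
    then show ?thesis
      by simp
  qed
  then show ?thesis
    using \<open>n \<in> N\<close> that unfolding orth_compl_def by blast
qed

text \<open>The summand of the frame inequality at \<open>x = u l\<close> that belongs to \<open>l\<close> alone is \<open>norm (u l) ^ 4\<close>.\<close>

lemma frame_norm_bound:
  assumes "l \<in> \<Lambda>" and "(\<lambda>j. (norm (ip (u j) (u l)))\<^sup>2) summable_on \<Lambda>"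
    and "(\<Sum>\<^sub>\<infinity>j\<in>\<Lambda>. (norm (ip (u j) (u l)))\<^sup>2) \<le> B * (norm (u l))\<^sup>2" and "0 < B"
  shows "norm (u l) \<le> sqrt B"
proof (cases "u l = 0")
  case False
  have "((norm (u l))\<^sup>2)\<^sup>2 = (\<Sum>j\<in>{l}. (norm (ip (u j) (u l)))\<^sup>2)"
    by (simp add: norm_ip_self)
  also have "\<dots> \<le> (\<Sum>\<^sub>\<infinity>j\<in>\<Lambda>. (norm (ip (u j) (u l)))\<^sup>2)"
    using assms(1,2) by (intro finite_sum_le_infsum) auto
  also have "\<dots> \<le> B * (norm (u l))\<^sup>2"
    by fact
  finally have "(norm (u l))\<^sup>2 * (norm (u l))\<^sup>2 \<le> B * (norm (u l))\<^sup>2"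
    by (simp only: power2_eq_square)
  then have "(norm (u l))\<^sup>2 \<le> B"
    by (rule mult_right_le_imp_le) (use False in simp)
  then show ?thesis
    by (rule real_le_rsqrt)
qed (use assms(4) in simp)

end

section \<open>Closed operators and their Moore--Penrose inverse\<close>

locale closed_operator = X: hilbert_space scaleX ipX + Y: hilbert_space scaleY ipY
  for scaleX :: "'k::rc_field \<Rightarrow> 'x::banach \<Rightarrow> 'x" and ipX :: "'x \<Rightarrow> 'x \<Rightarrow> 'k"
    and scaleY :: "'k \<Rightarrow> 'y::banach \<Rightarrow> 'y" and ipY :: "'y \<Rightarrow> 'y \<Rightarrow> 'k" +
  fixes D :: "'x set" and K :: "'x \<Rightarrow> 'y"
  assumes closed_densely_defined: "closed_densely_defined scaleX scaleY D K"
begin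

lemma subspace_dom: "X.subspace D"
  and add: "x \<in> D \<Longrightarrow> y \<in> D \<Longrightarrow> K (x + y) = K x + K y"
  and scale: "x \<in> D \<Longrightarrow> K (scaleX c x) = scaleY c (K x)"
  and dense: "closure D = UNIV"
  and closed_graph: "closed {(x, K x) | x. x \<in> D}"
  using closed_densely_defined unfolding closed_densely_defined_def by auto

lemma diff: "x \<in> D \<Longrightarrow> y \<in> D \<Longrightarrow> K (x - y) = K x - K y"
  using add[of "x - y" y] X.subspace_diff[OF subspace_dom] by simp

lemma subspace_ker: "X.subspace (op_ker D K)"
proof -
  have "K 0 = 0"
    using diff[of 0 0] X.subspace_0[OF subspace_dom] by simp
  then show ?thesis
    unfolding X.subspace_def op_ker_def
    using subspace_dom by (auto simp: add scale X.subspace_def)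
qed

lemma closed_ker: "closed (op_ker D K)"
proof -
  have "closed ((\<lambda>x. (x, 0::'y)) -` {(x, K x) | x. x \<in> D})"
    using closed_graph by (intro closed_vimage continuous_intros)
  moreover have "op_ker D K = (\<lambda>x. (x, 0::'y)) -` {(x, K x) | x. x \<in> D}"
    unfolding op_ker_def by auto
  ultimately show ?thesis
    by simp
qed

text \<open>
  The kernel component of a vector of the domain lies in the domain, so the component orthogonal to
  the kernel does too. Hence every value of the operator is attained orthogonally to its kernel.
\<close>

lemma ran_eq_image_orth_ker:
  assumes "r \<in> op_ran D K"
  obtains x where "x \<in> D \<inter> orth_compl ipX (op_ker D K)" "K x = r"
proof -
  obtain d where d: "d \<in> D" "K d = r"
    using assms unfolding op_ran_def by auto
  obtain n where n: "n \<in> op_ker D K" "d - n \<in> orth_compl ipX (op_ker D K)"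
    using subspace_ker closed_ker by (rule X.orthogonal_decomposition)
  have "d - n \<in> D \<and> K (d - n) = r"
    using d n(1) X.subspace_diff[OF subspace_dom] by (auto simp: op_ker_def diff)
  then show ?thesis
    using n(2) that by blast
qed

lemma orth_proj_closure_ran:
  assumes "r \<in> op_ran D K" and "s \<in> orth_compl ipY (op_ran D K)"
  shows "orth_proj ipY (closure (op_ran D K)) (r + s) = r"
  unfolding orth_proj_def
proof (rule the_equality)
  show "r \<in> closure (op_ran D K) \<and> r + s - r \<in> orth_compl ipY (closure (op_ran D K))"
    using assms closure_subset[of "op_ran D K"] by (auto simp: Y.orth_compl_closure)
next
  fix p
  assume p: "p \<in> closure (op_ran D K) \<and> r + s - p \<in> orth_compl ipY (closure (op_ran D K))"
  have r: "r \<in> closure (op_ran D K)"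
    using assms(1) closure_subset by blast
  have orth: "ipY (r - p) q = 0" if "q \<in> closure (op_ran D K)" for q
  proof -
    have "ipY (r + s - p) q = 0" "ipY s q = 0"
      using p assms(2) that unfolding Y.orth_compl_closure[symmetric, of "op_ran D K"]
      by (simp_all add: orth_compl_def)
    then show ?thesis
      by (simp add: Y.ip_diff_left Y.ip_add_left)
  qed
  have "ipY (r - p) (r - p) = 0"
    using orth[of r] orth[of p] p r by (simp add: Y.ip_diff_right)
  then show "p = r"
    using Y.ip_self_eq_0D by force
qed

lemma mp_inverse_eq:
  assumes x: "x \<in> D \<inter> orth_compl ipX (op_ker D K)"
    and s: "s \<in> orth_compl ipY (op_ran D K)"
  shows "mp_inverse ipX ipY D K (K x + s) = x"
proof -
  have "orth_proj ipY (closure (op_ran D K)) (K x + s) = K x"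
    using x s by (intro orth_proj_closure_ran) (auto simp: op_ran_def)
  moreover have "x' = x" if x': "x' \<in> D \<inter> orth_compl ipX (op_ker D K)" "K x' = K x" for x'
  proof -
    have "x' - x \<in> op_ker D K"
      using x x' X.subspace_diff[OF subspace_dom] by (auto simp: op_ker_def diff)
    then have "ipX (x' - x) (x' - x) = 0"
      using x x' by (simp add: X.ip_diff_left orth_compl_def)
    then show ?thesis
      using X.ip_self_eq_0D by force
  qed
  ultimately show ?thesis
    unfolding mp_inverse_def using x by (intro the_equality) auto
qed

text \<open>
  By Pythagoras, dropping the part of the data orthogonal to the range only decreases the norm,
  while the inverse keeps its value; so the estimate is decided on the range.
\<close>

lemma mp_bounded_iff:
  "mp_bounded ipX ipY D K \<longleftrightarrow>
    (\<exists>C>0. \<forall>x \<in> D \<inter> orth_compl ipX (op_ker D K). norm x \<le> C * norm (K x))"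
proof
  assume "mp_bounded ipX ipY D K"
  then obtain C where C: "\<forall>y\<in>mp_dom ipY D K. norm (mp_inverse ipX ipY D K y) \<le> C * norm y"
    unfolding mp_bounded_def by blast
  \<comment> \<open>The definition puts no sign on \<open>C\<close>; the shift makes the constant positive.\<close>
  have "norm x \<le> (\<bar>C\<bar> + 1) * norm (K x)" if x: "x \<in> D \<inter> orth_compl ipX (op_ker D K)" for x
  proof -
    have s: "0 \<in> orth_compl ipY (op_ran D K)"
      by (simp add: orth_compl_def)
    then have "K x + 0 \<in> mp_dom ipY D K"
      using x unfolding mp_dom_def op_ran_def by blast
    then have "norm x \<le> C * norm (K x)"
      using C mp_inverse_eq[OF x s] by fastforce
    also have "\<dots> \<le> (\<bar>C\<bar> + 1) * norm (K x)"
      by (intro mult_right_mono) auto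
    finally show ?thesis .
  qed
  then show "\<exists>C>0. \<forall>x \<in> D \<inter> orth_compl ipX (op_ker D K). norm x \<le> C * norm (K x)"
    by (intro exI[of _ "\<bar>C\<bar> + 1"]) auto
next
  assume "\<exists>C>0. \<forall>x \<in> D \<inter> orth_compl ipX (op_ker D K). norm x \<le> C * norm (K x)"
  then obtain C where "0 < C"
    and C: "\<And>x. x \<in> D \<inter> orth_compl ipX (op_ker D K) \<Longrightarrow> norm x \<le> C * norm (K x)"
    by blast
  have "norm (mp_inverse ipX ipY D K y) \<le> C * norm y" if "y \<in> mp_dom ipY D K" for y
  proof -
    obtain r s where r: "r \<in> op_ran D K" and s: "s \<in> orth_compl ipY (op_ran D K)"
      and y: "y = r + s"
      using \<open>y \<in> mp_dom ipY D K\<close> unfolding mp_dom_def by blast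
    obtain x where x: "x \<in> D \<inter> orth_compl ipX (op_ker D K)" and Kx: "K x = r"
      using r by (rule ran_eq_image_orth_ker)
    have "ipY r s = 0"
      by (rule Y.ip_zero_commute) (use r s in \<open>auto simp: orth_compl_def\<close>)
    then have "(norm r)\<^sup>2 \<le> (norm y)\<^sup>2"
      by (simp add: y Y.pythagoras)
    then have "norm r \<le> norm y"
      by (simp add: power2_le_iff_abs_le)
    then have "norm x \<le> C * norm y"
      using C[OF x] \<open>0 < C\<close> by (simp add: Kx) (meson mult_left_mono less_imp_le order_trans)
    then show ?thesis
      using mp_inverse_eq[OF x s] by (simp add: Kx y)
  qed
  then show "mp_bounded ipX ipY D K"
    unfolding mp_bounded_def by blast
qed

lemma ip_adj:
  assumes "w \<in> adj_dom ipX ipY D K" and "x \<in> D"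
  shows "ipY (K x) w = ipX x (adj ipX ipY D K w)"
proof -
  obtain z where z: "\<forall>x\<in>D. ipY (K x) w = ipX x z"
    using assms(1) unfolding adj_dom_def by blast
  have "z' = z" if "\<forall>x\<in>D. ipY (K x) w = ipX x z'" for z'
  proof -
    have "z' - z \<in> orth_compl ipX D"
      unfolding orth_compl_def
      by (intro CollectI ballI, rule X.ip_zero_commute) (use z that in \<open>simp add: X.ip_diff_right\<close>)
    then have "z' - z \<in> orth_compl ipX UNIV"
      by (metis X.orth_compl_closure dense)
    then show ?thesis
      using X.ip_self_eq_0D by (force simp: orth_compl_def)
  qed
  then have "adj ipX ipY D K w = z"
    unfolding adj_def using z by (intro the_equality) auto
  then show ?thesis
    using z assms(2) by simp
qed

text \<open>
  On the range, \<open>ip (K x) w = ip x (adj w)\<close> with \<open>norm x \<le> C * norm (K x)\<close> bounds the functional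
  \<open>ip _ w\<close> by \<open>C * norm (adj w)\<close>. The bound extends to the closure of the range, where \<open>w\<close>
  itself can be inserted.
\<close>

lemma adj_bounded_below:
  assumes "0 \<le> C"
    and C: "\<And>x. x \<in> D \<inter> orth_compl ipX (op_ker D K) \<Longrightarrow> norm x \<le> C * norm (K x)"
    and w: "w \<in> adj_dom ipX ipY D K" "w \<in> closure (op_ran D K)"
  shows "norm w \<le> C * norm (adj ipX ipY D K w)"
proof -
  have "norm (ipY r w) \<le> (C * norm (adj ipX ipY D K w)) * norm r" if "r \<in> op_ran D K" for r
  proof -
    obtain x where x: "x \<in> D \<inter> orth_compl ipX (op_ker D K)" and Kx: "K x = r"
      using \<open>r \<in> op_ran D K\<close> by (rule ran_eq_image_orth_ker)
    have "norm (ipY r w) = norm (ipX x (adj ipX ipY D K w))"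
      using ip_adj[OF w(1)] x Kx by auto
    also have "\<dots> \<le> norm x * norm (adj ipX ipY D K w)"
      by (rule X.cauchy_schwarz)
    also have "\<dots> \<le> (C * norm r) * norm (adj ipX ipY D K w)"
      using C[OF x] by (intro mult_right_mono) (auto simp: Kx)
    finally show ?thesis
      by (simp add: mult_ac)
  qed
  then have "norm (ipY w w) \<le> (C * norm (adj ipX ipY D K w)) * norm w"
    using w(2) by (rule Y.norm_ip_le_closure)
  then have "norm w * norm w \<le> (C * norm (adj ipX ipY D K w)) * norm w"
    by (simp add: Y.norm_ip_self power2_eq_square)
  then show ?thesis
    using \<open>0 \<le> C\<close> by (cases "w = 0") (auto intro: mult_right_le_imp_le[of _ "norm w"])
qed

section \<open>Diagonal frame decompositions\<close>

lemma DFD_coefficients: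
  assumes "is_DFD ipX ipY D K \<Lambda> u v \<kappa>" and "l \<in> \<Lambda>" and "x \<in> D"
  shows "norm (ipY (v l) (K x)) = \<kappa> l * norm (ipX (u l) x)"
proof -
  have "v l \<in> adj_dom ipX ipY D K" "adj ipX ipY D K (v l) = \<kappa> l *\<^sub>R u l" "0 < \<kappa> l"
    using assms(1,2) unfolding is_DFD_def by auto
  then have "norm (ipY (K x) (v l)) = norm (ipX x (\<kappa> l *\<^sub>R u l))"
    using ip_adj assms(3) by metis
  then show ?thesis
    using \<open>0 < \<kappa> l\<close>
    by (simp add: Y.norm_ip_commute[of "v l"] X.norm_ip_commute[of x] X.ip_scaleR_left)
qed

lemma DFD_imp_mp_bounded:
  assumes dfd: "is_DFD ipX ipY D K \<Lambda> u v \<kappa>" and "0 < c" and \<kappa>: "\<And>l. l \<in> \<Lambda> \<Longrightarrow> c \<le> \<kappa> l"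
  shows "mp_bounded ipX ipY D K"
proof -
  have u: "is_frame ipX (orth_compl ipX (op_ker D K)) \<Lambda> u"
    and v: "is_frame ipY (closure (op_ran D K)) \<Lambda> v"
    using dfd unfolding is_DFD_def by auto
  obtain A where "0 < A" and A: "\<And>x. x \<in> orth_compl ipX (op_ker D K) \<Longrightarrow>
      (\<lambda>l. (norm (ipX (u l) x))\<^sup>2) summable_on \<Lambda> \<and>
      A * (norm x)\<^sup>2 \<le> (\<Sum>\<^sub>\<infinity>l\<in>\<Lambda>. (norm (ipX (u l) x))\<^sup>2)"
    using u unfolding is_frame_def by meson
  obtain B where "0 < B" and B: "\<And>y. y \<in> closure (op_ran D K) \<Longrightarrow>
      (\<lambda>l. (norm (ipY (v l) y))\<^sup>2) summable_on \<Lambda> \<and>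
      (\<Sum>\<^sub>\<infinity>l\<in>\<Lambda>. (norm (ipY (v l) y))\<^sup>2) \<le> B * (norm y)\<^sup>2"
    using v unfolding is_frame_def by meson
  have "norm x \<le> sqrt (B / A) / c * norm (K x)"
    if x: "x \<in> D \<inter> orth_compl ipX (op_ker D K)" for x
  proof -
    have Kx: "K x \<in> closure (op_ran D K)"
      using x closure_subset[of "op_ran D K"] by (auto simp: op_ran_def)
    have "c\<^sup>2 * (A * (norm x)\<^sup>2) \<le> c\<^sup>2 * (\<Sum>\<^sub>\<infinity>l\<in>\<Lambda>. (norm (ipX (u l) x))\<^sup>2)"
      using A x by (intro mult_left_mono) auto
    also have "\<dots> = (\<Sum>\<^sub>\<infinity>l\<in>\<Lambda>. c\<^sup>2 * (norm (ipX (u l) x))\<^sup>2)"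
      by (rule infsum_cmult_right[symmetric]) (use A x in auto)
    also have "\<dots> \<le> (\<Sum>\<^sub>\<infinity>l\<in>\<Lambda>. (norm (ipY (v l) (K x)))\<^sup>2)"
    proof (rule infsum_mono)
      show "(\<lambda>l. c\<^sup>2 * (norm (ipX (u l) x))\<^sup>2) summable_on \<Lambda>"
        using A x by (intro summable_on_cmult_right) auto
      show "(\<lambda>l. (norm (ipY (v l) (K x)))\<^sup>2) summable_on \<Lambda>"
        using B[OF Kx] by blast
      fix l
      assume "l \<in> \<Lambda>"
      then have "c * norm (ipX (u l) x) \<le> norm (ipY (v l) (K x))"
        using DFD_coefficients[OF dfd, of l x] \<kappa>[of l] x by (simp add: mult_right_mono)
      then have "(c * norm (ipX (u l) x))\<^sup>2 \<le> (norm (ipY (v l) (K x)))\<^sup>2"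
        using \<open>0 < c\<close> by (intro power_mono) auto
      then show "c\<^sup>2 * (norm (ipX (u l) x))\<^sup>2 \<le> (norm (ipY (v l) (K x)))\<^sup>2"
        by (simp add: power_mult_distrib)
    qed
    also have "\<dots> \<le> B * (norm (K x))\<^sup>2"
      using B[OF Kx] by blast
    finally have "(norm x)\<^sup>2 \<le> (B / A) / c\<^sup>2 * (norm (K x))\<^sup>2"
      using \<open>0 < A\<close> \<open>0 < c\<close> by (simp add: field_simps)
    also have "\<dots> = (sqrt (B / A) / c * norm (K x))\<^sup>2"
      using \<open>0 < A\<close> \<open>0 < B\<close> by (simp add: power_mult_distrib power_divide)
    finally show ?thesis
      by (rule power2_le_imp_le) (use \<open>0 < A\<close> \<open>0 < B\<close> \<open>0 < c\<close> in simp)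
  qed
  moreover have "0 < sqrt (B / A) / c"
    using \<open>0 < A\<close> \<open>0 < B\<close> \<open>0 < c\<close> by simp
  ultimately show ?thesis
    unfolding mp_bounded_iff by blast
qed

lemma mp_bounded_imp_DFD_bounded_below:
  assumes dfd: "is_DFD ipX ipY D K \<Lambda> u v \<kappa>" and "mp_bounded ipX ipY D K"
  obtains M where "0 < M" and "\<And>l. l \<in> \<Lambda> \<Longrightarrow> norm (v l) \<le> M * \<kappa> l"
proof -
  obtain C where "0 < C"
    and C: "\<And>x. x \<in> D \<inter> orth_compl ipX (op_ker D K) \<Longrightarrow> norm x \<le> C * norm (K x)"
    using assms(2) unfolding mp_bounded_iff by blast
  have u: "is_frame ipX (orth_compl ipX (op_ker D K)) \<Lambda> u"
    and v: "is_frame ipY (closure (op_ran D K)) \<Lambda> v"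
    using dfd unfolding is_DFD_def by auto
  obtain B where "0 < B" and B: "\<And>x. x \<in> orth_compl ipX (op_ker D K) \<Longrightarrow>
      (\<lambda>l. (norm (ipX (u l) x))\<^sup>2) summable_on \<Lambda> \<and>
      (\<Sum>\<^sub>\<infinity>l\<in>\<Lambda>. (norm (ipX (u l) x))\<^sup>2) \<le> B * (norm x)\<^sup>2"
    using u unfolding is_frame_def by meson
  have "norm (v l) \<le> (C * sqrt B) * \<kappa> l" if l: "l \<in> \<Lambda>" for l
  proof -
    have "u l \<in> orth_compl ipX (op_ker D K)" "v l \<in> closure (op_ran D K)"
      using u v l unfolding is_frame_def by auto
    then have "norm (u l) \<le> sqrt B"
      using B \<open>0 < B\<close> l by (intro X.frame_norm_bound) auto
    have "v l \<in> adj_dom ipX ipY D K" "adj ipX ipY D K (v l) = \<kappa> l *\<^sub>R u l" "0 < \<kappa> l"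
      using dfd l unfolding is_DFD_def by auto
    then have "norm (v l) \<le> C * (\<kappa> l * norm (u l))"
      using adj_bounded_below[OF _ C, of "v l"] \<open>0 < C\<close> \<open>v l \<in> closure (op_ran D K)\<close> by simp
    also have "\<dots> \<le> C * (\<kappa> l * sqrt B)"
      using \<open>norm (u l) \<le> sqrt B\<close> \<open>0 < C\<close> \<open>0 < \<kappa> l\<close> by (intro mult_left_mono) auto
    finally show ?thesis
      by (simp add: mult_ac)
  qed
  moreover have "0 < C * sqrt B"
    using \<open>0 < C\<close> \<open>0 < B\<close> by simp
  ultimately show ?thesis
    using that by blast
qed

end

text \<open>Over an empty index set the infimum is infinite, and any positive bound will do.\<close>

lemma INF_ereal_pos_iff:
  fixes f :: "'i \<Rightarrow> real"
  shows "(INF l\<in>\<Lambda>. ereal (f l)) > 0 \<longleftrightarrow> (\<exists>c>0. \<forall>l\<in>\<Lambda>. c \<le> f l)"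
proof
  assume "(INF l\<in>\<Lambda>. ereal (f l)) > 0"
  then obtain c where c: "0 < ereal c" "ereal c < (INF l\<in>\<Lambda>. ereal (f l))"
    using ereal_dense2 by blast
  have "c \<le> f l" if "l \<in> \<Lambda>" for l
    using c(2) INF_lower[OF that, of "\<lambda>l. ereal (f l)"]
    by (metis ereal_less_eq(3) less_imp_le order_trans)
  then show "\<exists>c>0. \<forall>l\<in>\<Lambda>. c \<le> f l"
    using c(1) by auto
next
  assume "\<exists>c>0. \<forall>l\<in>\<Lambda>. c \<le> f l"
  then obtain c where "0 < c" and c: "\<forall>l\<in>\<Lambda>. c \<le> f l"
    by blast
  have "ereal c \<le> (INF l\<in>\<Lambda>. ereal (f l))"
    using c by (intro INF_greatest) simp
  with \<open>0 < c\<close> show "(INF l\<in>\<Lambda>. ereal (f l)) > 0"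
    by (metis ereal_less(2) less_le_trans)
qed

theorem theorem2p10:
  fixes scaleX :: "'k::rc_field \<Rightarrow> 'x::banach \<Rightarrow> 'x" and ipX :: "'x \<Rightarrow> 'x \<Rightarrow> 'k"
    and scaleY :: "'k \<Rightarrow> 'y::banach \<Rightarrow> 'y" and ipY :: "'y \<Rightarrow> 'y \<Rightarrow> 'k"
    and D :: "'x set" and K :: "'x \<Rightarrow> 'y"
    and \<Lambda> :: "'i set" and u :: "'i \<Rightarrow> 'x" and v :: "'i \<Rightarrow> 'y" and \<kappa> :: "'i \<Rightarrow> real"
  assumes "hilbert_space scaleX ipX"
    and "hilbert_space scaleY ipY"
    and "closed_densely_defined scaleX scaleY D K"
    and "countable \<Lambda>"
    and "is_DFD ipX ipY D K \<Lambda> u v \<kappa>"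
  shows "((INF l\<in>\<Lambda>. ereal (\<kappa> l)) > 0 \<longrightarrow> mp_bounded ipX ipY D K) \<and>
         (norm_bounded_below \<Lambda> v \<and> mp_bounded ipX ipY D K \<longrightarrow> (INF l\<in>\<Lambda>. ereal (\<kappa> l)) > 0)"
proof -
  interpret closed_operator scaleX ipX scaleY ipY D K
    using assms(1-3) by (intro closed_operator.intro closed_operator_axioms.intro)
  show ?thesis
  proof (intro conjI impI; (elim conjE)?)
    assume "(INF l\<in>\<Lambda>. ereal (\<kappa> l)) > 0"
    then show "mp_bounded ipX ipY D K"
      using DFD_imp_mp_bounded[OF assms(5)] unfolding INF_ereal_pos_iff by blast
  next
    assume "norm_bounded_below \<Lambda> v" and bounded: "mp_bounded ipX ipY D K"
    then obtain a where "0 < a" and "ereal a \<le> (INF l\<in>\<Lambda>. ereal (norm (v l)))"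
      unfolding norm_bounded_below_def by blast
    then have a: "a \<le> norm (v l)" if "l \<in> \<Lambda>" for l
      using that by (auto simp: le_INF_iff)
    obtain M where "0 < M" and M: "\<And>l. l \<in> \<Lambda> \<Longrightarrow> norm (v l) \<le> M * \<kappa> l"
      using mp_bounded_imp_DFD_bounded_below[OF assms(5) bounded] by blast
    have "a / M \<le> \<kappa> l" if "l \<in> \<Lambda>" for l
      using a[OF that] M[OF that] \<open>0 < M\<close> by (simp add: field_simps)
    then show "(INF l\<in>\<Lambda>. ereal (\<kappa> l)) > 0"
      unfolding INF_ereal_pos_iff using \<open>0 < a\<close> \<open>0 < M\<close> by (intro exI[of _ "a / M"]) auto
  qed
qed

end
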